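(* Fix a voting protocol and a class $\mathcal{D}$ of allowed distributions over votes (i.e. arbitrary restrictions on the distribution; $\mathcal{D}$ may be the class of all representable distributions). If UNCERTAIN-VOTES-CONSTRUCTIVE-WEIGHTED-EVALUATION (UVCWE) with the distribution over the votes required to be in $\mathcal{D}$ is $\mathcal{NP}$-hard for this protocol, then UNCERTAIN-VOTES-CONSTRUCTIVE-INDIVIDUAL-WEIGHTED-MANIPULATION (UVCIWM) with the distribution over the others' votes required to be in $\mathcal{D}$ is also $\mathcal{NP}$-hard for it. Moreover, for any $k$, the same implication holds when both problems are restricted to instances with $k$ candidates.
   Context: An election consists of a set of candidates, a set of voters each casting a vote (a total order on the candidates), and a winner determination function given by the voting protocol. Voters have nonnegative integer weights (weight $0$ is allowed), encoded in binary; a vote of weight $k$ is interpreted as $k$ identical unweighted votes. If the protocol leaves ties unresolved, they are broken against the candidate $p$ (the same way in both problems below). Distributions are given in some fixed representation language, the same for both problems. UVCWE (for a given protocol): given a weight for each voter, a distribution over all the votes, a candidate $p$, and a number $r$ with $0\le r\le 1$, decide whether the probability that $p$ wins is greater than $r$. UVCIWM (for a given protocol): given a single manipulative voter with a weight, weights for all the other voters, a distribution over all the others' votes, a candidate $p$, and a number $r$ with $0\le r\le 1$, decide whether the manipulator can cast its vote so that $p$ wins with probability greater than $r$. *)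

theory Defs
  imports "HOL-Computational_Algebra.Polynomial" "HOL-Probability.Probability_Mass_Function"
begin

section \<open>Polynomial-time functions, NP and NP-hardness\<close>

text \<open>
  Deterministic multi-tape Turing machines with an additional write-only output tape, on which a
  step may append one bit.  The work tapes are infinite in both directions; the first one initially
  holds the input.  States and tape symbols are initial segments of the natural numbers; symbol 0 is
  the blank, symbols 1 and 2 stand for the bits False and True.  A machine starts in state 0 and
  halts when the transition function yields None.
\<close>

datatype move = MoveLeft | Stay | MoveRight

record tm =
  num_tapes :: nat
  num_states :: nat
  num_symbols :: nat
  delta :: "nat \<Rightarrow> nat list \<Rightarrow> (nat \<times> (nat \<times> move) list \<times> bool option) option"

definition wf_tm :: "tm \<Rightarrow> bool" where
  "wf_tm M \<longleftrightarrow> 1 \<le> num_tapes M \<and> 1 \<le> num_states M \<and> 3 \<le> num_symbols M \<and>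
     (\<forall>q syms q' acts b.
        q < num_states M \<longrightarrow> length syms = num_tapes M \<longrightarrow> (\<forall>s\<in>set syms. s < num_symbols M) \<longrightarrow>
        delta M q syms = Some (q', acts, b) \<longrightarrow>
        q' < num_states M \<and> length acts = num_tapes M \<and> (\<forall>(s, d)\<in>set acts. s < num_symbols M))"

type_synonym tape = "(int \<Rightarrow> nat) \<times> int"
type_synonym config = "nat \<times> tape list \<times> bool list"

fun read_tape :: "tape \<Rightarrow> nat" where
  "read_tape (c, h) = c h"

fun move_offset :: "move \<Rightarrow> int" where
  "move_offset MoveLeft = -1"
| "move_offset Stay = 0"
| "move_offset MoveRight = 1"

fun act_tape :: "nat \<times> move \<Rightarrow> tape \<Rightarrow> tape" where
  "act_tape (s, d) (c, h) = (c(h := s), h + move_offset d)"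

fun halted :: "tm \<Rightarrow> config \<Rightarrow> bool" where
  "halted M (q, ts, out) \<longleftrightarrow> delta M q (map read_tape ts) = None"

text \<open>A halted configuration steps to itself.\<close>

fun step :: "tm \<Rightarrow> config \<Rightarrow> config" where
  "step M (q, ts, out) =
     (case delta M q (map read_tape ts) of
        None \<Rightarrow> (q, ts, out)
      | Some (q', acts, b) \<Rightarrow>
          (q', map2 act_tape acts ts, out @ (case b of None \<Rightarrow> [] | Some c \<Rightarrow> [c])))"

definition input_tape :: "bool list \<Rightarrow> tape" where
  "input_tape x =
     ((\<lambda>i. if 0 \<le> i \<and> i < int (length x) then (if x ! nat i then 2 else 1) else 0), 0)"

definition blank_tape :: tape where
  "blank_tape = ((\<lambda>_. 0), 0)"

definition init_config :: "tm \<Rightarrow> bool list \<Rightarrow> config" where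
  "init_config M x = (0, input_tape x # replicate (num_tapes M - 1) blank_tape, [])"

definition computes_within :: "tm \<Rightarrow> bool list \<Rightarrow> bool list \<Rightarrow> nat \<Rightarrow> bool" where
  "computes_within M x y t \<longleftrightarrow>
     (let c = (step M ^^ t) (init_config M x) in halted M c \<and> snd (snd c) = y)"

definition polytime :: "(bool list \<Rightarrow> bool list) \<Rightarrow> bool" where
  "polytime f \<longleftrightarrow>
     (\<exists>M (p :: nat poly). wf_tm M \<and> (\<forall>x. computes_within M x (f x) (poly p (length x))))"

text \<open>A self-delimiting encoding of bit strings: a True before each bit, a False at the end.\<close>

fun delim :: "bool list \<Rightarrow> bool list" where
  "delim [] = [False]"
| "delim (b # bs) = True # b # delim bs"

text \<open>Languages having polynomial-time verifiers for certificates of polynomial length.\<close>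

definition NP :: "bool list set set" where
  "NP = {L. \<exists>V (p :: nat poly). polytime V \<and>
           (\<forall>x. x \<in> L \<longleftrightarrow> (\<exists>u. length u \<le> poly p (length x) \<and> V (delim x @ u) = [True]))}"

text \<open>
  A decision problem consists of a set of instances, an encoding of them as bit strings, and the
  predicate characterizing the yes-instances.  A reduction must map every string to (the encoding
  of) an instance of the problem, so hardness of a restricted problem does not come from the
  difficulty of recognizing which inputs satisfy the restriction.
\<close>

definition NP_hard :: "('i \<Rightarrow> bool list) \<Rightarrow> 'i set \<Rightarrow> ('i \<Rightarrow> bool) \<Rightarrow> bool" where
  "NP_hard enc instances yes \<longleftrightarrow>
     (\<forall>L\<in>NP. \<exists>f. polytime f \<and> (\<forall>x. \<exists>i\<in>instances. f x = enc i \<and> (x \<in> L \<longleftrightarrow> yes i)))"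


section \<open>Elections\<close>

text \<open>
  Candidates are named by natural numbers.  A vote is a (reflexive) linear order on the candidate
  set.  The votes of an election form a list; a protocol need not be anonymous, and may declare
  several candidates, or none, to be winners.
\<close>

type_synonym vote = "nat rel"
type_synonym protocol = "nat set \<Rightarrow> vote list \<Rightarrow> nat set"

definition voting_protocol :: "protocol \<Rightarrow> bool" where
  "voting_protocol W \<longleftrightarrow>
     (\<forall>C vs. finite C \<longrightarrow> C \<noteq> {} \<longrightarrow> (\<forall>v\<in>set vs. linear_order_on C v) \<longrightarrow> W C vs \<subseteq> C)"

text \<open>A vote of weight k counts as k identical unweighted votes.\<close>

definition unweighted :: "nat list \<Rightarrow> vote list \<Rightarrow> vote list" where
  "unweighted ws vs = concat (map2 replicate ws vs)"

text \<open>Ties that the protocol leaves unresolved are broken against p.\<close>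

definition wins :: "protocol \<Rightarrow> nat set \<Rightarrow> nat list \<Rightarrow> vote list \<Rightarrow> nat \<Rightarrow> bool" where
  "wins W C ws vs p \<longleftrightarrow> W C (unweighted ws vs) = {p}"


section \<open>The decision problems\<close>

text \<open>
  A representation language assigns to a bit string the joint distribution over the votes which it
  represents (None if it represents no distribution), relative to the set of candidates and the
  number of voters whose votes are uncertain.
\<close>

type_synonym representation = "nat set \<Rightarrow> nat \<Rightarrow> bool list \<Rightarrow> vote list pmf option"

text \<open>
  The part that is common to both problems.  The voters listed here are those with uncertain
  votes: all the voters in UVCWE, all except the manipulator in UVCIWM.
\<close>

record uv_instance =
  candidates :: "nat list"
  weights :: "nat list"
  dist_code :: "bool list"
  preferred :: nat
  threshold :: rat

definition cand_set :: "uv_instance \<Rightarrow> nat set" where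
  "cand_set I = set (candidates I)"

definition vote_dist :: "representation \<Rightarrow> uv_instance \<Rightarrow> vote list pmf option" where
  "vote_dist R I = R (cand_set I) (length (weights I)) (dist_code I)"

definition valid_instance :: "representation \<Rightarrow> vote list pmf set \<Rightarrow> uv_instance \<Rightarrow> bool" where
  "valid_instance R \<D> I \<longleftrightarrow>
     distinct (candidates I) \<and> preferred I \<in> cand_set I \<and> 0 \<le> threshold I \<and> threshold I \<le> 1 \<and>
     (\<exists>P. vote_dist R I = Some P \<and> P \<in> \<D> \<and>
        (\<forall>vs\<in>set_pmf P. length vs = length (weights I) \<and>
                         (\<forall>v\<in>set vs. linear_order_on (cand_set I) v)))"

definition UVCWE_instances :: "representation \<Rightarrow> vote list pmf set \<Rightarrow> uv_instance set" where
  "UVCWE_instances R \<D> = {I. valid_instance R \<D> I}"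

definition UVCWE :: "protocol \<Rightarrow> representation \<Rightarrow> uv_instance \<Rightarrow> bool" where
  "UVCWE W R I \<longleftrightarrow>
     measure_pmf.prob (the (vote_dist R I))
       {vs. wins W (cand_set I) (weights I) vs (preferred I)} > of_rat (threshold I)"

text \<open>
  An instance of UVCIWM additionally has the manipulator's weight.  The manipulator
  is the first voter of the election, which matters only for protocols that are not anonymous.
\<close>

definition UVCIWM_instances ::
    "representation \<Rightarrow> vote list pmf set \<Rightarrow> (nat \<times> uv_instance) set" where
  "UVCIWM_instances R \<D> = {(w, I). valid_instance R \<D> I}"

definition UVCIWM :: "protocol \<Rightarrow> representation \<Rightarrow> nat \<times> uv_instance \<Rightarrow> bool" where
  "UVCIWM W R = (\<lambda>(w, I).
     \<exists>v. linear_order_on (cand_set I) v \<and>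
       measure_pmf.prob (the (vote_dist R I))
         {vs. wins W (cand_set I) (w # weights I) (v # vs) (preferred I)} > of_rat (threshold I))"


section \<open>Encoding of instances\<close>

text \<open>
  Binary, least significant bit first, without leading zeros (so 0 is the empty string).
\<close>

fun binary :: "nat \<Rightarrow> bool list" where
  "binary n = (if n = 0 then [] else odd n # binary (n div 2))"

declare binary.simps [simp del]

definition enc_nat :: "nat \<Rightarrow> bool list" where
  "enc_nat n = delim (binary n)"

fun enc_nats :: "nat list \<Rightarrow> bool list" where
  "enc_nats [] = [False]"
| "enc_nats (n # ns) = True # enc_nat n @ enc_nats ns"

text \<open>Only used for nonnegative numbers.\<close>

definition enc_rat :: "rat \<Rightarrow> bool list" where
  "enc_rat r = (case quotient_of r of (a, b) \<Rightarrow> enc_nat (nat a) @ enc_nat (nat b))"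

definition enc_UVCWE :: "uv_instance \<Rightarrow> bool list" where
  "enc_UVCWE I = enc_nats (candidates I) @ enc_nats (weights I) @ delim (dist_code I) @
     enc_nat (preferred I) @ enc_rat (threshold I)"

definition enc_UVCIWM :: "nat \<times> uv_instance \<Rightarrow> bool list" where
  "enc_UVCIWM = (\<lambda>(w, I). enc_nat w @ enc_UVCWE I)"

text \<open>Both encodings are injective on instances.\<close>

lemma delim_append_eq: "delim a @ u = delim b @ v \<longleftrightarrow> a = b \<and> u = v"
proof (induction a arbitrary: b)
  case Nil
  then show ?case by (cases b) auto
next
  case (Cons x a)
  then show ?case by (cases b) auto
qed

lemma binary_inject: "binary m = binary n \<longleftrightarrow> m = n"
proof
  show "binary m = binary n \<Longrightarrow> m = n"
  proof (induction m arbitrary: n rule: less_induct)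
    case (less m)
    show ?case
    proof (cases "m = 0 \<or> n = 0")
      case True
      then show ?thesis using less.prems binary.simps[of m] binary.simps[of n]
        by (auto split: if_splits)
    next
      case False
      then have eq: "odd m = odd n" "binary (m div 2) = binary (n div 2)"
        using less.prems binary.simps[of m] binary.simps[of n] by auto
      have "m div 2 = n div 2"
        by (rule less.IH) (use False eq in auto)
      with eq(1) show ?thesis
        by (metis dvd_mult_div_cancel odd_two_times_div_two_succ)
    qed
  qed
qed auto

lemma enc_nat_append_eq: "enc_nat m @ u = enc_nat n @ v \<longleftrightarrow> m = n \<and> u = v"
  by (simp add: enc_nat_def delim_append_eq binary_inject)

lemma enc_nats_append_eq: "enc_nats a @ u = enc_nats b @ v \<longleftrightarrow> a = b \<and> u = v"
proof (induction a arbitrary: b)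
  case Nil
  then show ?case by (cases b) auto
next
  case (Cons x a)
  then show ?case by (cases b) (auto simp: enc_nat_append_eq)
qed

lemma enc_rat_inject:
  assumes "0 \<le> r" "0 \<le> s" "enc_rat r = enc_rat s"
  shows "r = s"
proof -
  obtain a b where r: "quotient_of r = (a, b)" by (cases "quotient_of r")
  obtain c d where s: "quotient_of s = (c, d)" by (cases "quotient_of s")
  have pos: "0 < b" "0 < d" using r s quotient_of_denom_pos by auto
  have "0 \<le> a" "0 \<le> c"
    using assms(1,2) quotient_of_div[OF r] quotient_of_div[OF s] pos
    by (auto simp: zero_le_divide_iff)
  moreover have "enc_nat (nat a) @ enc_nat (nat b) @ [] = enc_nat (nat c) @ enc_nat (nat d) @ []"
    using assms(3) by (simp add: enc_rat_def r s)
  then have "nat a = nat c" "nat b = nat d" unfolding enc_nat_append_eq by auto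
  ultimately have "a = c" "b = d" using pos by auto
  then show ?thesis using r s quotient_of_inject by metis
qed

lemma inj_on_enc_UVCWE: "inj_on enc_UVCWE (UVCWE_instances R \<D>)"
  by (rule inj_onI, rule uv_instance.equality)
    (auto simp: enc_UVCWE_def UVCWE_instances_def valid_instance_def enc_nats_append_eq
      delim_append_eq enc_nat_append_eq intro: enc_rat_inject)

lemma inj_on_enc_UVCIWM: "inj_on enc_UVCIWM (UVCIWM_instances R \<D>)"
  using inj_on_enc_UVCWE[of R \<D>]
  by (auto simp: inj_on_def enc_UVCIWM_def UVCIWM_instances_def UVCWE_instances_def
      enc_nat_append_eq)

end

(*
  A manipulator of weight 0 contributes no unweighted votes, so pairing an evaluation instance with
  such a manipulator preserves the answer, the candidates and the distribution.  Weight 0 is encoded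
  by the single bit False, so the reduction merely prepends this bit to the encoded instance.
*)

theory Submission
  imports Defs
begin

section \<open>Prepending a bit to the output of a Turing machine\<close>

text \<open>The new state 0 emits the bit; state Suc q plays the role of state q of M.\<close>

fun prepend_delta ::
    "bool \<Rightarrow> tm \<Rightarrow> nat \<Rightarrow> nat list \<Rightarrow> (nat \<times> (nat \<times> move) list \<times> bool option) option" where
  "prepend_delta b M 0 syms = Some (1, map (\<lambda>s. (s, Stay)) syms, Some b)"
| "prepend_delta b M (Suc q) syms = map_option (apfst Suc) (delta M q syms)"

definition prepend_tm :: "bool \<Rightarrow> tm \<Rightarrow> tm" where
  "prepend_tm b M =
     \<lparr>num_tapes = num_tapes M, num_states = Suc (num_states M), num_symbols = num_symbols M,
      delta = prepend_delta b M\<rparr>"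

lemma prepend_tm_simps [simp]:
  "num_tapes (prepend_tm b M) = num_tapes M"
  "num_states (prepend_tm b M) = Suc (num_states M)"
  "num_symbols (prepend_tm b M) = num_symbols M"
  "delta (prepend_tm b M) = prepend_delta b M"
  by (simp_all add: prepend_tm_def)

lemma wf_prepend_tm:
  assumes "wf_tm M"
  shows "wf_tm (prepend_tm b M)"
  unfolding wf_tm_def
proof (intro conjI allI impI)
  fix q syms q' acts b'
  assume q: "q < num_states (prepend_tm b M)"
    and len: "length syms = num_tapes (prepend_tm b M)"
    and syms: "\<forall>s\<in>set syms. s < num_symbols (prepend_tm b M)"
    and delta: "delta (prepend_tm b M) q syms = Some (q', acts, b')"
  have "q' < num_states (prepend_tm b M) \<and> length acts = num_tapes (prepend_tm b M) \<and>
      (\<forall>(s, d)\<in>set acts. s < num_symbols (prepend_tm b M))"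
  proof (cases q)
    case 0
    \<comment> \<open>State 1 is legal because \<open>M\<close> has at least one state; the symbols
      written back are the ones just read.\<close>
    then show ?thesis using assms len syms delta by (auto simp: wf_tm_def)
  next
    case (Suc r)
    then obtain r' where "delta M r syms = Some (r', acts, b')" "q' = Suc r'"
      using delta by auto
    then show ?thesis using assms q len syms Suc unfolding wf_tm_def by auto
  qed
  then show "q' < num_states (prepend_tm b M)" "length acts = num_tapes (prepend_tm b M)"
    "\<forall>(s, d)\<in>set acts. s < num_symbols (prepend_tm b M)" by blast+
qed (use assms in \<open>auto simp: wf_tm_def\<close>)

text \<open>The simulation invariant from the first step on: same tapes, shifted state, and the
  extra bit already at the front of the output.\<close>

fun prepend_config :: "bool \<Rightarrow> config \<Rightarrow> config" where
  "prepend_config b (q, ts, out) = (Suc q, ts, b # out)"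

text \<open>Later output is appended at the far end, so it never disturbs the leading bit. Halted
  configurations are fixed by \<open>step\<close> on both sides, so the equation can be iterated any
  number of times.\<close>

lemma step_prepend_tm: "step (prepend_tm b M) (prepend_config b c) = prepend_config b (step M c)"
  by (cases c) (auto split: option.splits)

lemma steps_prepend_tm:
  "(step (prepend_tm b M) ^^ t) (prepend_config b c) = prepend_config b ((step M ^^ t) c)"
  by (induction t) (simp_all add: step_prepend_tm)

lemma halted_prepend_tm: "halted (prepend_tm b M) (prepend_config b c) = halted M c"
  by (cases c) simp

text \<open>Every step must write on every tape; writing back the symbol just read, without moving,
  leaves the input intact for the simulation.\<close>

lemma rewrite_tapes: "map2 act_tape (map (\<lambda>s. (s, Stay)) (map read_tape ts)) ts = ts"
  by (induction ts) auto

lemma step_init_prepend_tm: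
  "step (prepend_tm b M) (init_config (prepend_tm b M) x) = prepend_config b (init_config M x)"
  using rewrite_tapes[of "input_tape x # replicate (num_tapes M - 1) blank_tape"]
  by (simp add: init_config_def)

lemma computes_within_prepend_tm:
  assumes "computes_within M x y t"
  shows "computes_within (prepend_tm b M) x (b # y) (Suc t)"
proof -
  have "(step (prepend_tm b M) ^^ Suc t) (init_config (prepend_tm b M) x) =
      prepend_config b ((step M ^^ t) (init_config M x))"
    \<comment> \<open>\<open>funpow_Suc_right\<close> splits off the first step, the one that emits
      the bit, instead of the last.\<close>
    by (simp add: funpow_Suc_right step_init_prepend_tm steps_prepend_tm del: funpow.simps)
  moreover have "snd (snd (prepend_config b c)) = b # snd (snd c)" for c
    by (cases c) simp
  ultimately show ?thesis
    using assms by (simp add: computes_within_def Let_def halted_prepend_tm del: funpow.simps)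
qed

lemma polytime_prepend:
  assumes "polytime f"
  shows "polytime (\<lambda>x. b # f x)"
proof -
  obtain M and p :: "nat poly" where "wf_tm M"
    and "\<And>x. computes_within M x (f x) (poly p (length x))"
    using assms by (auto simp: polytime_def)
  then have "wf_tm (prepend_tm b M)"
    \<comment> \<open>The summand 1 pays for the emitting step.\<close>
    "computes_within (prepend_tm b M) x (b # f x) (poly (p + 1) (length x))" for x
    using wf_prepend_tm computes_within_prepend_tm by auto
  then show ?thesis unfolding polytime_def by blast
qed


section \<open>A manipulator of weight zero\<close>

text \<open>At weight 0 the winning condition does not depend on the manipulator's vote, so the
  existential in \<open>UVCIWM\<close> only asks that some vote exist.\<close>

lemma ex_linear_order_on:
  fixes C :: "'a :: linorder set"
  shows "\<exists>v. linear_order_on C v"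
proof
  show "linear_order_on C {(a, b). a \<in> C \<and> b \<in> C \<and> a \<le> b}"
    by (auto simp: linear_order_on_def partial_order_on_def preorder_on_def refl_on_def
        trans_def antisym_def total_on_def)
qed

text \<open>\<open>replicate 0 v\<close> is empty, so \<open>W\<close> receives literally the same
  vote list, whether or not it is anonymous.\<close>

lemma wins_weight_0: "wins W C (0 # ws) (v # vs) p = wins W C ws vs p"
  by (simp add: wins_def unweighted_def)

lemma UVCIWM_weight_0: "UVCIWM W R (0, I) = UVCWE W R I"
  by (simp add: UVCIWM_def UVCWE_def wins_weight_0 ex_linear_order_on)

lemma enc_UVCIWM_weight_0: "enc_UVCIWM (0, I) = False # enc_UVCWE I"
  by (simp add: enc_UVCIWM_def enc_nat_def binary.simps)

text \<open>The instance sets are left abstract so that the unrestricted claim and the one for k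
  candidates are both special cases.\<close>

lemma NP_hard_UVCIWM:
  assumes hard: "NP_hard enc_UVCWE A (UVCWE W R)" and sub: "\<And>I. I \<in> A \<Longrightarrow> (0, I) \<in> B"
  shows "NP_hard enc_UVCIWM B (UVCIWM W R)"
  unfolding NP_hard_def
proof
  fix L
  assume "L \<in> NP"
  then obtain f where "polytime f"
    and f: "\<And>x. \<exists>I\<in>A. f x = enc_UVCWE I \<and> (x \<in> L \<longleftrightarrow> UVCWE W R I)"
    using hard unfolding NP_hard_def by blast
  have "\<exists>i\<in>B. False # f x = enc_UVCIWM i \<and> (x \<in> L \<longleftrightarrow> UVCIWM W R i)" for x
    using f[of x] sub enc_UVCIWM_weight_0 UVCIWM_weight_0 by metis
  then show "\<exists>g. polytime g \<and> (\<forall>x. \<exists>i\<in>B. g x = enc_UVCIWM i \<and> (x \<in> L \<longleftrightarrow> UVCIWM W R i))"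
    using polytime_prepend[OF \<open>polytime f\<close>] by blast
qed

theorem theorem10:
  fixes W :: protocol and R :: representation and \<D> :: "vote list pmf set"
  assumes "voting_protocol W"
  shows
    "(NP_hard enc_UVCWE (UVCWE_instances R \<D>) (UVCWE W R) \<longrightarrow>
      NP_hard enc_UVCIWM (UVCIWM_instances R \<D>) (UVCIWM W R)) \<and>
     (\<forall>k. NP_hard enc_UVCWE {I \<in> UVCWE_instances R \<D>. card (cand_set I) = k} (UVCWE W R) \<longrightarrow>
          NP_hard enc_UVCIWM {(w, I) \<in> UVCIWM_instances R \<D>. card (cand_set I) = k} (UVCIWM W R))"
  \<comment> \<open>What remains is membership of \<open>(0, I)\<close>: validity and the candidate
    set depend on \<open>I\<close> alone.\<close>
  by (intro conjI allI impI; erule NP_hard_UVCIWM)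
    (auto simp: UVCWE_instances_def UVCIWM_instances_def)

end
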